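(* The sequence $\{\varphi^+(n)\}_{n=1}^\infty$ contains infinitely many arithmetic progressions of length $3$; that is, there are infinitely many pairs $(x,d)$ of positive integers such that each of $x$, $x+d$, $x+2d$ is a term of the sequence, i.e. $x=\varphi^+(a)$, $x+d=\varphi^+(b)$, $x+2d=\varphi^+(c)$ for some positive integers $a,b,c$.
   Context: Here $\varphi$ is Euler's totient function and $v_p(n)$ is the exponent of the highest power of the prime $p$ dividing $n$. The function $\varphi^+$ is defined on positive integers by $\varphi^+(1)=1$ and $\varphi^+(n)=\prod_{p\mid n}\left(\varphi(p^{v_p(n)})+1\right)$ for $n\ge 2$, the product being over the distinct primes $p$ dividing $n$. *)

theory Defs
  imports "HOL-Number_Theory.Number_Theory"
begin

(* For n = 1 the product is empty, giving the value 1.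
   The value at n = 0 is junk (also an empty product). *)
definition phi_plus :: "nat \<Rightarrow> nat" where
  "phi_plus n = (\<Prod>p\<in>prime_factors n. (totient (p ^ multiplicity p n) + 1))"

end

(* On squarefree numbers phi_plus is the identity, since totient p + 1 = p.  Hence every
   prime q > 3 gives the progression q, 2q, 3q of squarefree terms. *)
theory Submission
  imports Defs "HOL-Computational_Algebra.Squarefree"
begin

text \<open>A prime occurring to the first power contributes (p - 1) + 1 = p to the product, so
  \<open>phi_plus\<close> fixes every squarefree number (\<open>phi_plus_squarefree\<close>). For a
  prime q other than 2 and 3, the numbers q, 2q, 3q are squarefree, so they are terms in progression
  with x = d = q. Euclid's theorem supplies infinitely many such q.\<close>

lemma phi_plus_squarefree:
  assumes "squarefree n"
  shows "phi_plus n = n"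
proof -
  have n: "n \<noteq> 0"
    using assms by (intro notI) simp
  have "phi_plus n = (\<Prod>p\<in>prime_factors n. p ^ multiplicity p n)"
    unfolding phi_plus_def
  proof (rule prod.cong)
    fix p assume p: "p \<in> prime_factors n"
    then have "prime p" by auto
    moreover from p assms n have "multiplicity p n = 1"
      by (auto simp: squarefree_factorial_semiring')
    \<comment> \<open>Positivity of p makes the truncated difference in p - 1 + 1 = p
      harmless.\<close>
    ultimately show "totient (p ^ multiplicity p n) + 1 = p ^ multiplicity p n"
      using prime_gt_0_nat[of p] by (simp add: totient_prime)
  qed simp
  also have "\<dots> = n"
    using prod_prime_factors[OF n] by simp
  finally show ?thesis .
qed

lemma squarefree_mult_primes:
  fixes p q :: nat
  assumes "prime p" "prime q" "p \<noteq> q"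
  shows "squarefree (p * q)"
  using assms by (intro squarefree_mult_coprime squarefree_prime primes_coprime)

theorem theorem2p11:
  "infinite {(x :: nat, d :: nat). x > 0 \<and> d > 0 \<and>
     (\<exists>a>0. x = phi_plus a) \<and>
     (\<exists>b>0. x + d = phi_plus b) \<and>
     (\<exists>c>0. x + 2 * d = phi_plus c)}"
  (is "infinite ?S")
proof -
  \<comment> \<open>At q = 2 or q = 3 one of 2q, 3q is a square, and \<open>phi_plus\<close> moves
    it: 4 goes to 3 and 9 goes to 7.\<close>
  let ?Q = "{q :: nat. prime q} - {2, 3}"
  have "(\<lambda>q. (q, q)) ` ?Q \<subseteq> ?S"
  proof (rule image_subsetI)
    fix q assume "q \<in> ?Q"
    then have q: "prime q" "q \<noteq> 2" "q \<noteq> 3" by auto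
    then have pos: "q > 0" by (simp add: prime_gt_0_nat)
    have "q = phi_plus q"
      using q by (simp add: phi_plus_squarefree squarefree_prime)
    moreover have "q + q = phi_plus (2 * q)"
      using q by (simp add: phi_plus_squarefree squarefree_mult_primes)
    moreover have "q + 2 * q = phi_plus (3 * q)"
      using q by (simp add: phi_plus_squarefree squarefree_mult_primes)
    moreover have "2 * q > 0" "3 * q > 0"
      using pos by simp_all
    ultimately show "(q, q) \<in> ?S"
      using pos by blast
  qed
  \<comment> \<open>The diagonal map is injective, and dropping two primes leaves infinitely
    many.\<close>
  moreover have "infinite ((\<lambda>q. (q, q)) ` ?Q)"
    using primes_infinite by (subst finite_image_iff) (auto simp: inj_on_def)
  ultimately show ?thesis
    by (rule infinite_super)
qed

end
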